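(* Let $m,n\ge 2$. If $K$ and $L$ are bifix-free regular languages over a finite alphabet $\Sigma$ with $\kappa(K)=m$ and $\kappa(L)=n$, then $\kappa(KL)\le m+n-2$, where $KL$ is the concatenation of $K$ and $L$. Furthermore, for all $m,n\ge2$ there are subword-free languages $K$ and $L$ over a one-letter alphabet with $\kappa(K)=m$ and $\kappa(L)=n$ that meet this bound, i.e. $\kappa(KL)=m+n-2$.
   Context: For a language $L\subseteq\Sigma^*$ over a finite non-empty alphabet $\Sigma$ and a word $w\in\Sigma^*$, the (left) quotient of $L$ by $w$ is $L_w=\{x\in\Sigma^*\mid wx\in L\}$. The quotient complexity $\kappa(L)$ of a regular language $L$ is the number of distinct quotients $L_w$, $w\in\Sigma^*$; it equals the number of states of the minimal complete deterministic finite automaton accepting $L$ over $\Sigma$. A language $L$ is prefix-free (respectively suffix-free, subword-free) if, whenever $u,v\in L$ and $u$ is a prefix (respectively suffix, subword) of $v$, then $u=v$; here "subword" means a (not necessarily contiguous) subsequence. A language is bifix-free if it is both prefix-free and suffix-free. *)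

theory Defs
  imports Main "HOL-Library.Sublist"
begin

text \<open>
  Words over an alphabet \<open>\<Sigma>\<close> are the elements of \<^term>\<open>lists \<Sigma>\<close>. The alphabet is an explicit
  set rather than a type because quotient complexity depends on it: a quotient that is empty may
  arise only by using letters that do not occur in the language.
\<close>

definition conc :: "'a list set \<Rightarrow> 'a list set \<Rightarrow> 'a list set" (infixr "\<cdot>" 75) where
  "K \<cdot> L = {u @ v | u v. u \<in> K \<and> v \<in> L}"

definition left_quotient :: "'a set \<Rightarrow> 'a list set \<Rightarrow> 'a list \<Rightarrow> 'a list set" where
  "left_quotient \<Sigma> L w = {x \<in> lists \<Sigma>. w @ x \<in> L}"

definition quotients :: "'a set \<Rightarrow> 'a list set \<Rightarrow> 'a list set set" where
  "quotients \<Sigma> L = {left_quotient \<Sigma> L w | w. w \<in> lists \<Sigma>}"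

text \<open>
  The value is meaningful only when there are finitely many quotients. By the lemmas
  \<open>finite_quotients_regular\<close> and \<open>regular_conc\<close> below, this is the case for regular languages
  and for their concatenations.
\<close>

definition quotient_complexity :: "'a set \<Rightarrow> 'a list set \<Rightarrow> nat" where
  "quotient_complexity \<Sigma> L = card (quotients \<Sigma> L)"

text \<open>
  Acceptance by a complete deterministic finite automaton over \<open>\<Sigma>\<close>. Natural numbers suffice as
  states, since the set of states is finite.
\<close>

definition regular_language :: "'a set \<Rightarrow> 'a list set \<Rightarrow> bool" where
  "regular_language \<Sigma> L \<longleftrightarrow>
     (\<exists>(Q :: nat set) \<delta> q\<^sub>0 F. finite Q \<and> q\<^sub>0 \<in> Q \<and> F \<subseteq> Q \<and> (\<forall>q\<in>Q. \<forall>a\<in>\<Sigma>. \<delta> q a \<in> Q) \<and>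
        L = {w \<in> lists \<Sigma>. foldl \<delta> q\<^sub>0 w \<in> F})"

definition prefix_free :: "'a list set \<Rightarrow> bool" where
  "prefix_free L \<longleftrightarrow> (\<forall>u\<in>L. \<forall>v\<in>L. prefix u v \<longrightarrow> u = v)"

definition suffix_free :: "'a list set \<Rightarrow> bool" where
  "suffix_free L \<longleftrightarrow> (\<forall>u\<in>L. \<forall>v\<in>L. suffix u v \<longrightarrow> u = v)"

definition subword_free :: "'a list set \<Rightarrow> bool" where
  "subword_free L \<longleftrightarrow> (\<forall>u\<in>L. \<forall>v\<in>L. subseq u v \<longrightarrow> u = v)"

definition bifix_free :: "'a list set \<Rightarrow> bool" where
  "bifix_free L \<longleftrightarrow> prefix_free L \<and> suffix_free L"

lemma regular_language_subset: "regular_language \<Sigma> L \<Longrightarrow> L \<subseteq> lists \<Sigma>"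
  by (auto simp: regular_language_def)

lemma foldl_closed:
  "\<lbrakk>\<forall>q\<in>Q. \<forall>a\<in>\<Sigma>. \<delta> q a \<in> Q; q \<in> Q; w \<in> lists \<Sigma>\<rbrakk> \<Longrightarrow> foldl \<delta> q w \<in> Q"
  by (induction w arbitrary: q) auto

lemma finite_quotients_regular:
  assumes "regular_language \<Sigma> L"
  shows "finite (quotients \<Sigma> L)"
proof -
  obtain Q :: "nat set" and \<delta> q0 F where A: "finite Q" "q0 \<in> Q"
    "\<forall>q\<in>Q. \<forall>a\<in>\<Sigma>. \<delta> q a \<in> Q" "L = {w \<in> lists \<Sigma>. foldl \<delta> q0 w \<in> F}"
    using assms unfolding regular_language_def by blast
  have "left_quotient \<Sigma> L w = {x \<in> lists \<Sigma>. foldl \<delta> (foldl \<delta> q0 w) x \<in> F}"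
    if "w \<in> lists \<Sigma>" for w
    using that by (auto simp: left_quotient_def A(4))
  hence "quotients \<Sigma> L \<subseteq> (\<lambda>q. {x \<in> lists \<Sigma>. foldl \<delta> q x \<in> F}) ` Q"
    using foldl_closed[OF A(3,2)] unfolding quotients_def by blast
  thus ?thesis
    using A(1) finite_surj by blast
qed

lemma regular_if_finite_quotients:
  assumes "L \<subseteq> lists \<Sigma>" "finite (quotients \<Sigma> L)"
  shows "regular_language \<Sigma> L"
proof -
  let ?step = "\<lambda>X a. left_quotient \<Sigma> X [a]"
  obtain f :: "'a list set \<Rightarrow> nat" where f: "inj_on f (quotients \<Sigma> L)"
    using finite_imp_inj_to_nat_seg[OF assms(2)] by blast
  let ?g = "inv_into (quotients \<Sigma> L) f"
  define \<delta> where "\<delta> = (\<lambda>q a. f (?step (?g q) a))"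
  have step: "?step (left_quotient \<Sigma> L w) a = left_quotient \<Sigma> L (w @ [a])" if "a \<in> \<Sigma>" for w a
    using that by (auto simp: left_quotient_def)
  have in_q: "left_quotient \<Sigma> L w \<in> quotients \<Sigma> L" if "w \<in> lists \<Sigma>" for w
    using that by (auto simp: quotients_def)
  have \<delta>: "\<delta> (f (left_quotient \<Sigma> L w)) a = f (left_quotient \<Sigma> L (w @ [a]))"
    if "w \<in> lists \<Sigma>" "a \<in> \<Sigma>" for w a
    using that by (simp add: \<delta>_def inv_into_f_f[OF f] in_q step)
  have run: "foldl \<delta> (f (left_quotient \<Sigma> L [])) w = f (left_quotient \<Sigma> L w)"
    if "w \<in> lists \<Sigma>" for w
    using that
  proof (induction w rule: rev_induct)
    case (snoc a w)
    then show ?case using \<delta>[of w a] by simp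
  qed simp
  have "finite (f ` quotients \<Sigma> L)" using assms(2) by simp
  moreover have "f (left_quotient \<Sigma> L []) \<in> f ` quotients \<Sigma> L"
    using in_q[of "[]"] by simp
  moreover have "f ` {X \<in> quotients \<Sigma> L. [] \<in> X} \<subseteq> f ` quotients \<Sigma> L" by blast
  moreover have "\<forall>q\<in>f ` quotients \<Sigma> L. \<forall>a\<in>\<Sigma>. \<delta> q a \<in> f ` quotients \<Sigma> L"
  proof (intro ballI)
    fix q a assume q: "q \<in> f ` quotients \<Sigma> L" and a: "a \<in> \<Sigma>"
    from q obtain w where w: "w \<in> lists \<Sigma>" "q = f (left_quotient \<Sigma> L w)"
      by (auto simp: quotients_def)
    show "\<delta> q a \<in> f ` quotients \<Sigma> L"
      using \<delta>[OF w(1) a] in_q[of "w @ [a]"] w a by simp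
  qed
  moreover have "L = {w \<in> lists \<Sigma>.
      foldl \<delta> (f (left_quotient \<Sigma> L [])) w \<in> f ` {X \<in> quotients \<Sigma> L. [] \<in> X}}"
  proof -
    have "foldl \<delta> (f (left_quotient \<Sigma> L [])) w \<in> f ` {X \<in> quotients \<Sigma> L. [] \<in> X} \<longleftrightarrow> w \<in> L"
      if w: "w \<in> lists \<Sigma>" for w
    proof -
      have "f (left_quotient \<Sigma> L w) \<in> f ` {X \<in> quotients \<Sigma> L. [] \<in> X}
          \<longleftrightarrow> left_quotient \<Sigma> L w \<in> {X \<in> quotients \<Sigma> L. [] \<in> X}"
        by (rule inj_on_image_mem_iff[OF f in_q[OF w]]) blast
      also have "\<dots> \<longleftrightarrow> w \<in> L"
        using in_q[OF w] by (simp add: left_quotient_def)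
      finally show ?thesis by (simp add: run[OF w])
    qed
    thus ?thesis using assms(1) by blast
  qed
  ultimately show ?thesis
    unfolding regular_language_def by blast
qed

lemma regular_conc:
  assumes "regular_language \<Sigma> K" "regular_language \<Sigma> L"
  shows "regular_language \<Sigma> (K \<cdot> L)"
proof (rule regular_if_finite_quotients)
  have K: "K \<subseteq> lists \<Sigma>" and L: "L \<subseteq> lists \<Sigma>"
    using assms by (simp_all add: regular_language_subset)
  show "K \<cdot> L \<subseteq> lists \<Sigma>"
    using K L by (fastforce simp: conc_def)
  let ?h = "\<lambda>(X, S). X \<cdot> L \<union> \<Union>S"
  let ?S = "\<lambda>w. {left_quotient \<Sigma> L v | u v. w = u @ v \<and> u \<in> K}"
  have eq: "left_quotient \<Sigma> (K \<cdot> L) w = ?h (left_quotient \<Sigma> K w, ?S w)" if w: "w \<in> lists \<Sigma>" for w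
  proof (intro set_eqI iffI)
    fix x assume "x \<in> left_quotient \<Sigma> (K \<cdot> L) w"
    then obtain u v where uv: "x \<in> lists \<Sigma>" "w @ x = u @ v" "u \<in> K" "v \<in> L"
      by (auto simp: left_quotient_def conc_def)
    from uv(2) obtain t where "(w = u @ t \<and> t @ x = v) \<or> (w @ t = u \<and> x = t @ v)"
      unfolding append_eq_append_conv2 by blast
    thus "x \<in> ?h (left_quotient \<Sigma> K w, ?S w)"
    proof
      assume "w = u @ t \<and> t @ x = v"
      hence "left_quotient \<Sigma> L t \<in> ?S w" "x \<in> left_quotient \<Sigma> L t"
        using uv by (auto simp: left_quotient_def)
      thus ?thesis by blast
    next
      assume t: "w @ t = u \<and> x = t @ v"
      hence "t \<in> left_quotient \<Sigma> K w"
        using uv by (auto simp: left_quotient_def)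
      hence "x \<in> left_quotient \<Sigma> K w \<cdot> L"
        using t uv by (auto simp: conc_def)
      thus ?thesis by simp
    qed
  next
    fix x assume "x \<in> ?h (left_quotient \<Sigma> K w, ?S w)"
    then consider "x \<in> left_quotient \<Sigma> K w \<cdot> L"
      | u v where "w = u @ v" "u \<in> K" "x \<in> left_quotient \<Sigma> L v"
      by auto
    thus "x \<in> left_quotient \<Sigma> (K \<cdot> L) w"
    proof cases
      case 1
      then obtain t v where tv: "x = t @ v" "t \<in> lists \<Sigma>" "w @ t \<in> K" "v \<in> L"
        by (auto simp: left_quotient_def conc_def)
      have "w @ x = (w @ t) @ v" "x \<in> lists \<Sigma>" using tv L by auto
      thus ?thesis using tv(3,4) unfolding left_quotient_def conc_def by blast
    next
      case 2
      have "w @ x = u @ (v @ x)" using 2 by simp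
      thus ?thesis using 2 unfolding left_quotient_def conc_def by blast
    qed
  qed
  have "quotients \<Sigma> (K \<cdot> L) \<subseteq> ?h ` (quotients \<Sigma> K \<times> Pow (quotients \<Sigma> L))"
  proof
    fix X assume "X \<in> quotients \<Sigma> (K \<cdot> L)"
    then obtain w where w: "w \<in> lists \<Sigma>" "X = left_quotient \<Sigma> (K \<cdot> L) w"
      by (auto simp: quotients_def)
    have "(left_quotient \<Sigma> K w, ?S w) \<in> quotients \<Sigma> K \<times> Pow (quotients \<Sigma> L)"
      using w(1) by (auto simp: quotients_def)
    moreover have "X = ?h (left_quotient \<Sigma> K w, ?S w)"
      using eq[OF w(1)] w(2) by simp
    ultimately show "X \<in> ?h ` (quotients \<Sigma> K \<times> Pow (quotients \<Sigma> L))"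
      by (rule rev_image_eqI)
  qed
  moreover have "finite (quotients \<Sigma> K \<times> Pow (quotients \<Sigma> L))"
    using assms by (simp add: finite_quotients_regular)
  ultimately show "finite (quotients \<Sigma> (K \<cdot> L))"
    by (rule finite_subset[OF _ finite_imageI])
qed

end

theory Submission
  imports Defs
begin

text \<open>
  Only prefix-freeness matters for the upper bound. A word \<open>w\<close> has at most one prefix \<open>u\<close> in \<open>K\<close>.
  If \<open>w = uv\<close> with \<open>u \<in> K\<close>, then \<open>(KL)\<^sub>w = L\<^sub>v\<close>; otherwise \<open>(KL)\<^sub>w = K\<^sub>w L\<close>. In the second case
  \<open>K\<^sub>w\<close> is not \<open>{\<epsilon>}\<close>, and if it is empty it gives the empty quotient, which \<open>L\<close> already has.
  So at most \<open>m - 2\<close> quotients arise in addition to the \<open>n\<close> quotients of \<open>L\<close>. The bound is met by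
  \<open>{a\<^bsup>m-2\<^esup>}\<close> and \<open>{a\<^bsup>n-2\<^esup>}\<close>, since \<open>{a\<^bsup>k\<^esup>}\<close> has exactly the quotients \<open>\<emptyset>\<close> and \<open>{a\<^bsup>i\<^esup>}\<close>, \<open>i \<le> k\<close>.
\<close>

lemma left_quotient_in_quotients:
  "w \<in> lists \<Sigma> \<Longrightarrow> left_quotient \<Sigma> L w \<in> quotients \<Sigma> L"
  by (auto simp: quotients_def)

lemma quotients_empty: "quotients \<Sigma> {} = {{}}"
  by (auto simp: quotients_def left_quotient_def)

lemma left_quotient_prefix_free_mem:
  assumes "prefix_free L" "w \<in> L"
  shows "left_quotient \<Sigma> L w = {[]}"
  using assms by (fastforce simp: left_quotient_def prefix_free_def)

lemma left_quotient_prefix_free_append: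
  assumes "prefix_free L" "w \<in> L" "x \<noteq> []"
  shows "left_quotient \<Sigma> L (w @ x) = {}"
  using assms by (fastforce simp: left_quotient_def prefix_free_def)

lemma singleton_Nil_in_quotients:
  assumes "L \<subseteq> lists \<Sigma>" "prefix_free L" "L \<noteq> {}"
  shows "{[]} \<in> quotients \<Sigma> L"
  using assms left_quotient_prefix_free_mem left_quotient_in_quotients
  by (metis all_not_in_conv subsetD)

text \<open>A letter is needed to extend a word of \<open>L\<close> properly; by prefix-freeness no
  continuation returns to \<open>L\<close>.\<close>

lemma empty_in_quotients:
  assumes "L \<subseteq> lists \<Sigma>" "prefix_free L" "L \<noteq> {}" "\<Sigma> \<noteq> {}"
  shows "{} \<in> quotients \<Sigma> L"
proof -
  obtain w a where "w \<in> L" "a \<in> \<Sigma>" using assms by blast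
  moreover from this have "left_quotient \<Sigma> L (w @ [a]) \<in> quotients \<Sigma> L"
    using assms(1) by (intro left_quotient_in_quotients) auto
  ultimately show ?thesis
    using left_quotient_prefix_free_append[OF assms(2), of w "[a]" \<Sigma>] by simp
qed

text \<open>Two prefixes of one word are comparable, so prefix-freeness of \<open>K\<close> forces
  every factorization of \<open>u @ v @ x\<close> in \<open>K \<cdot> L\<close> to cut exactly after
  \<open>u\<close>.\<close>

lemma left_quotient_conc_prefix:
  assumes "prefix_free K" "u \<in> K"
  shows "left_quotient \<Sigma> (K \<cdot> L) (u @ v) = left_quotient \<Sigma> L v"
proof -
  have "v @ x \<in> L" if "u @ v @ x = u' @ v'" "u' \<in> K" "v' \<in> L" for x u' v'
  proof -
    have "prefix u u' \<or> prefix u' u"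
      using that(1) by (metis prefixI prefix_same_cases)
    hence "u = u'"
      using assms that(2) by (auto simp: prefix_free_def)
    thus ?thesis using that by simp
  qed
  moreover have "u @ v @ x \<in> K \<cdot> L" if "v @ x \<in> L" for x
    using that assms(2) by (auto simp: conc_def)
  ultimately show ?thesis
    by (auto simp: left_quotient_def conc_def)
qed

text \<open>Every factorization of \<open>w @ x\<close> must cut strictly beyond \<open>w\<close>,
  so its first factor is \<open>w @ t\<close> with \<open>t\<close> in the quotient of
  \<open>K\<close>.\<close>

lemma left_quotient_conc_no_prefix:
  assumes "K \<subseteq> lists \<Sigma>" "L \<subseteq> lists \<Sigma>" "\<And>u. prefix u w \<Longrightarrow> u \<notin> K"
  shows "left_quotient \<Sigma> (K \<cdot> L) w = left_quotient \<Sigma> K w \<cdot> L"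
proof (intro set_eqI iffI)
  fix x assume "x \<in> left_quotient \<Sigma> (K \<cdot> L) w"
  then obtain u v where uv: "w @ x = u @ v" "u \<in> K" "v \<in> L"
    by (auto simp: left_quotient_def conc_def)
  have "\<not> prefix u w" using assms(3) uv(2) by blast
  then obtain t where t: "u = w @ t" "x = t @ v"
    using uv(1) by (auto simp: append_eq_append_conv2 prefix_def)
  hence "t \<in> left_quotient \<Sigma> K w"
    using uv assms(1) by (auto simp: left_quotient_def)
  thus "x \<in> left_quotient \<Sigma> K w \<cdot> L"
    using t uv(3) by (auto simp: conc_def)
next
  fix x assume "x \<in> left_quotient \<Sigma> K w \<cdot> L"
  then obtain t v where tv: "x = t @ v" "t \<in> lists \<Sigma>" "w @ t \<in> K" "v \<in> L"
    by (auto simp: left_quotient_def conc_def)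
  have "w @ x = (w @ t) @ v" "x \<in> lists \<Sigma>" using tv assms(2) by auto
  thus "x \<in> left_quotient \<Sigma> (K \<cdot> L) w"
    using tv(3,4) unfolding left_quotient_def conc_def by blast
qed

lemma quotients_conc_prefix_free:
  assumes K: "K \<subseteq> lists \<Sigma>" "prefix_free K"
    and L: "L \<subseteq> lists \<Sigma>" "prefix_free L" "L \<noteq> {}"
    and "\<Sigma> \<noteq> {}"
  shows "quotients \<Sigma> (K \<cdot> L)
    \<subseteq> (\<lambda>X. X \<cdot> L) ` (quotients \<Sigma> K - {{}, {[]}}) \<union> quotients \<Sigma> L"
proof
  fix X assume "X \<in> quotients \<Sigma> (K \<cdot> L)"
  then obtain w where w: "w \<in> lists \<Sigma>" "X = left_quotient \<Sigma> (K \<cdot> L) w"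
    by (auto simp: quotients_def)
  show "X \<in> (\<lambda>X. X \<cdot> L) ` (quotients \<Sigma> K - {{}, {[]}}) \<union> quotients \<Sigma> L"
  proof (cases "\<exists>u. prefix u w \<and> u \<in> K")
    case True
    then obtain u v where "w = u @ v" "u \<in> K" by (auto simp: prefix_def)
    hence "X = left_quotient \<Sigma> L v" "v \<in> lists \<Sigma>"
      using w left_quotient_conc_prefix[OF K(2)] by auto
    thus ?thesis by (simp add: left_quotient_in_quotients)
  next
    case False
    let ?Y = "left_quotient \<Sigma> K w"
    have X: "X = ?Y \<cdot> L"
      using w(2) False left_quotient_conc_no_prefix[OF K(1) L(1)] by blast
    \<comment> \<open>Otherwise \<open>w\<close>, a prefix of itself, would lie in
      \<open>K\<close>.\<close>
    have "[] \<notin> ?Y"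
      using False by (auto simp: left_quotient_def)
    show ?thesis
    proof (cases "?Y = {}")
      case True
      hence "X = {}" using X by (simp add: conc_def)
      thus ?thesis using empty_in_quotients[OF L \<open>\<Sigma> \<noteq> {}\<close>] by simp
    next
      case False
      hence "?Y \<in> quotients \<Sigma> K - {{}, {[]}}"
        using \<open>[] \<notin> ?Y\<close> left_quotient_in_quotients[OF w(1)] by auto
      thus ?thesis using X by blast
    qed
  qed
qed

lemma quotient_complexity_conc_prefix_free:
  assumes "regular_language \<Sigma> K" "prefix_free K" "K \<noteq> {}"
    and "regular_language \<Sigma> L" "prefix_free L" "L \<noteq> {}"
    and "\<Sigma> \<noteq> {}"
  shows "quotient_complexity \<Sigma> (K \<cdot> L) \<le> quotient_complexity \<Sigma> K + quotient_complexity \<Sigma> L - 2"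
proof -
  let ?Q = "quotients \<Sigma> K - {{}, {[]}}"
  note sub = assms(1,4)[THEN regular_language_subset]
  note fin = assms(1,4)[THEN finite_quotients_regular]
  \<comment> \<open>Both removed sets really are quotients of \<open>K\<close>, so the difference
    loses exactly two elements.\<close>
  have two: "{{}, {[]}} \<subseteq> quotients \<Sigma> K"
    using empty_in_quotients[OF sub(1) assms(2,3,7)]
      singleton_Nil_in_quotients[OF sub(1) assms(2,3)] by simp
  \<comment> \<open>Subtraction on naturals truncates; this bound lets the \<open>- 2\<close> move
    outside the sum at the end.\<close>
  have ge: "2 \<le> card (quotients \<Sigma> K)"
    using card_mono[OF fin(1) two] by simp
  have "card ?Q = card (quotients \<Sigma> K) - 2"
    using card_Diff_subset[OF _ two] by simp
  have "card (quotients \<Sigma> (K \<cdot> L)) \<le> card ((\<lambda>X. X \<cdot> L) ` ?Q \<union> quotients \<Sigma> L)"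
    using quotients_conc_prefix_free[OF sub(1) assms(2) sub(2) assms(5-7)] fin
    by (intro card_mono) auto
  also have "\<dots> \<le> card ((\<lambda>X. X \<cdot> L) ` ?Q) + card (quotients \<Sigma> L)"
    by (rule card_Un_le)
  also have "\<dots> \<le> card ?Q + card (quotients \<Sigma> L)"
    using card_image_le[of ?Q] fin(1) by simp
  finally show ?thesis
    using \<open>card ?Q = _\<close> ge by (simp add: quotient_complexity_def)
qed

lemma lists_singleton: "lists {a} = range (\<lambda>n. replicate n a)"
  by (force simp: in_lists_conv_set intro: replicate_eqI)

lemma left_quotient_unary_word:
  "left_quotient {a} {replicate k a} (replicate i a)
     = (if i \<le> k then {replicate (k - i) a} else {})"
proof -
  have "i + j = k \<longleftrightarrow> i \<le> k \<and> j = k - i" for j by auto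
  thus ?thesis
    by (auto simp: left_quotient_def lists_singleton simp flip: replicate_add)
qed

lemma quotients_unary_word:
  "quotients {a} {replicate k a} = insert {} ((\<lambda>i. {replicate i a}) ` {..k})"
proof -
  let ?q = "\<lambda>i. left_quotient {a} {replicate k a} (replicate i a)"
  have "quotients {a} {replicate k a} = range ?q"
    by (auto simp: quotients_def lists_singleton)
  moreover have "range ?q \<subseteq> insert {} ((\<lambda>i. {replicate i a}) ` {..k})"
    by (auto simp: left_quotient_unary_word)
  \<comment> \<open>The exponent \<open>Suc k\<close> overshoots the only word. Deleting
    \<open>replicate_Suc\<close> keeps the word in the form that the preceding lemma
    rewrites.\<close>
  moreover have "{} \<in> range ?q"
    by (rule range_eqI[of _ _ "Suc k"]) (simp add: left_quotient_unary_word del: replicate_Suc)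
  moreover have "{replicate i a} \<in> range ?q" if "i \<le> k" for i
    using that by (intro range_eqI[of _ _ "k - i"]) (simp add: left_quotient_unary_word)
  ultimately show ?thesis by auto
qed

text \<open>There are \<open>k + 1\<close> remainders, for exponents 0 to \<open>k\<close>, and the
  empty quotient.\<close>

lemma quotient_complexity_unary_word:
  "quotient_complexity {a} {replicate k a} = k + 2"
proof -
  have "inj_on (\<lambda>i. {replicate i a}) {..k}"
    by (auto simp: inj_on_def)
  thus ?thesis
    by (auto simp: quotient_complexity_def quotients_unary_word card_image card_insert_if)
qed

lemma regular_unary_word: "regular_language {a} {replicate k a}"
  by (rule regular_if_finite_quotients) (auto simp: quotients_unary_word lists_singleton)

lemma subword_free_singleton: "subword_free {w}"
  by (simp add: subword_free_def)

lemma conc_unary_words: "{replicate i a} \<cdot> {replicate j a} = {replicate (i + j) a}"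
  by (simp add: conc_def replicate_add)

theorem theorem3:
  fixes m n :: nat
  assumes "m \<ge> 2" and "n \<ge> 2"
  shows "(\<forall>(\<Sigma> :: 'a set) K L.
            finite \<Sigma> \<and> \<Sigma> \<noteq> {} \<and>
            regular_language \<Sigma> K \<and> regular_language \<Sigma> L \<and>
            bifix_free K \<and> bifix_free L \<and>
            quotient_complexity \<Sigma> K = m \<and> quotient_complexity \<Sigma> L = n \<longrightarrow>
            quotient_complexity \<Sigma> (K \<cdot> L) \<le> m + n - 2) \<and>
         (\<forall>a :: 'b. \<exists>K L.
            regular_language {a} K \<and> regular_language {a} L \<and>
            subword_free K \<and> subword_free L \<and>
            quotient_complexity {a} K = m \<and> quotient_complexity {a} L = n \<and>
            quotient_complexity {a} (K \<cdot> L) = m + n - 2)"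
proof (intro conjI allI impI)
  fix \<Sigma> :: "'a set" and K L :: "'a list set"
  assume A: "finite \<Sigma> \<and> \<Sigma> \<noteq> {} \<and>
            regular_language \<Sigma> K \<and> regular_language \<Sigma> L \<and>
            bifix_free K \<and> bifix_free L \<and>
            quotient_complexity \<Sigma> K = m \<and> quotient_complexity \<Sigma> L = n"
  \<comment> \<open>The empty language has complexity 1, whereas \<open>m\<close> and
    \<open>n\<close> are at least 2.\<close>
  have "K \<noteq> {}" "L \<noteq> {}"
    using A assms by (auto simp: quotient_complexity_def quotients_empty)
  thus "quotient_complexity \<Sigma> (K \<cdot> L) \<le> m + n - 2"
    using A quotient_complexity_conc_prefix_free[of \<Sigma> K L] by (auto simp: bifix_free_def)
next
  fix a :: 'b
  \<comment> \<open>With these exponents the concatenation is a single word of length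
    \<open>i + j\<close>, of complexity \<open>i + j + 2 = m + n - 2\<close>.\<close>
  obtain i j where ij: "m = i + 2" "n = j + 2"
    using assms by (metis add.commute le_Suc_ex)
  let ?K = "{replicate i a}" and ?L = "{replicate j a}"
  show "\<exists>K L.
            regular_language {a} K \<and> regular_language {a} L \<and>
            subword_free K \<and> subword_free L \<and>
            quotient_complexity {a} K = m \<and> quotient_complexity {a} L = n \<and>
            quotient_complexity {a} (K \<cdot> L) = m + n - 2"
    by (rule exI[of _ ?K], rule exI[of _ ?L])
      (simp add: ij regular_unary_word subword_free_singleton conc_unary_words
        quotient_complexity_unary_word)
qed

end
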